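(* Let $\mathcal H$ be a real Hilbert space, let $A_1,A_2:\mathcal H\to2^{\mathcal H}$ be maximal monotone, and let $\lambda_1,\lambda_2>0$ with $\lambda_1+\lambda_2=1$. Let $J_A:=\lambda_1J_{A_1}+\lambda_2J_{A_2}$ and $$S:=\{(x,y)\in\mathcal H\times\mathcal H: x=J_{A_1/\lambda_2}y,\ y=J_{A_2/\lambda_1}x\}.$$ Define $T:S\to\operatorname{Fix}J_A:(x,y)\mapsto\lambda_1x+\lambda_2y$. Then $T$ is a homeomorphism, and its inverse is $$T^{-1}:\operatorname{Fix}J_A\to S: z\mapsto(J_{A_1}z,J_{A_2}z).$$ Consequently, $\operatorname{Fix}J_A=L(S)$, where $L:\mathcal H\times\mathcal H\to\mathcal H:(x,y)\mapsto\lambda_1x+\lambda_2y$.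
   Context: For a maximal monotone operator $B:\mathcal H\to2^{\mathcal H}$, the resolvent $J_B:=(B+\operatorname{Id})^{-1}$ is single-valued with full domain and regarded as a map $\mathcal H\to\mathcal H$. $B/\lambda$ denotes $x\mapsto\{u/\lambda:u\in Bx\}$. $\operatorname{Fix}T:=\{x:Tx=x\}$. A homeomorphism is a continuous bijection with continuous inverse (norm topologies). *)

theory Defs
  imports "HOL-Analysis.Analysis"
begin

text \<open>Set-valued operators on \<open>\<H>\<close> are functions \<open>'a \<Rightarrow> 'a set\<close>; a real Hilbert space is a type of
  sort \<open>{real_inner, complete_space}\<close>.\<close>

definition op_graph :: "('a \<Rightarrow> 'b set) \<Rightarrow> ('a \<times> 'b) set" where
  "op_graph B = {(x, u). u \<in> B x}"

definition monotone_operator :: "('a::real_inner \<Rightarrow> 'a set) \<Rightarrow> bool" where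
  "monotone_operator B \<longleftrightarrow>
     (\<forall>(x, u) \<in> op_graph B. \<forall>(y, v) \<in> op_graph B. (x - y) \<bullet> (u - v) \<ge> 0)"

definition maximal_monotone :: "('a::real_inner \<Rightarrow> 'a set) \<Rightarrow> bool" where
  "maximal_monotone B \<longleftrightarrow> monotone_operator B \<and>
     (\<forall>C. monotone_operator C \<and> op_graph B \<subseteq> op_graph C \<longrightarrow> op_graph C = op_graph B)"

definition op_add :: "('a \<Rightarrow> 'b::plus set) \<Rightarrow> ('a \<Rightarrow> 'b set) \<Rightarrow> 'a \<Rightarrow> 'b set" where
  "op_add B C x = {u + v |u v. u \<in> B x \<and> v \<in> C x}"

definition op_Id :: "'a \<Rightarrow> 'a set" where
  "op_Id x = {x}"

definition op_inverse :: "('a \<Rightarrow> 'b set) \<Rightarrow> 'b \<Rightarrow> 'a set" where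
  "op_inverse B u = {x. u \<in> B x}"

definition op_div :: "('a \<Rightarrow> 'b::real_vector set) \<Rightarrow> real \<Rightarrow> 'a \<Rightarrow> 'b set" where
  "op_div B c x = {u /\<^sub>R c |u. u \<in> B x}"

text \<open>The resolvent \<open>(B + Id)\<^sup>-\<^sup>1\<close> regarded as a map: its value at \<open>y\<close> is the unique element of
  \<open>(B + Id)\<^sup>-\<^sup>1 y\<close>. It is only meaningful where that set is a singleton, which for maximal
  monotone \<open>B\<close> on a Hilbert space is everywhere (Minty).\<close>

definition resolvent :: "('a::real_inner \<Rightarrow> 'a set) \<Rightarrow> 'a \<Rightarrow> 'a" where
  "resolvent B y = the_elem (op_inverse (op_add B op_Id) y)"

definition Fix :: "('a \<Rightarrow> 'a) \<Rightarrow> 'a set" where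
  "Fix T = {x. T x = x}"

definition resolvent_average ::
    "real \<Rightarrow> real \<Rightarrow> ('a::real_inner \<Rightarrow> 'a set) \<Rightarrow> ('a \<Rightarrow> 'a set) \<Rightarrow> 'a \<Rightarrow> 'a" where
  "resolvent_average l\<^sub>1 l\<^sub>2 A\<^sub>1 A\<^sub>2 z = l\<^sub>1 *\<^sub>R resolvent A\<^sub>1 z + l\<^sub>2 *\<^sub>R resolvent A\<^sub>2 z"

definition resolvent_cycles ::
    "real \<Rightarrow> real \<Rightarrow> ('a::real_inner \<Rightarrow> 'a set) \<Rightarrow> ('a \<Rightarrow> 'a set) \<Rightarrow> ('a \<times> 'a) set" where
  "resolvent_cycles l\<^sub>1 l\<^sub>2 A\<^sub>1 A\<^sub>2 =
     {(x, y). x = resolvent (op_div A\<^sub>1 l\<^sub>2) y \<and> y = resolvent (op_div A\<^sub>2 l\<^sub>1) x}"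

end

theory Submission
  imports Defs
begin

text \<open>
  For an operator \<open>B\<close> whose resolvent is everywhere defined, \<open>x = J\<^sub>B z\<close> just says
  \<open>z - x \<in> B x\<close>.  Put \<open>z = l\<^sub>1 x + l\<^sub>2 y\<close>.  As the weights add up to \<open>1\<close>,
  \<open>z - x = l\<^sub>2 (y - x)\<close> and \<open>z - y = l\<^sub>1 (x - y)\<close>, so the cycle conditions
  \<open>y - x \<in> A\<^sub>1 x / l\<^sub>2\<close> and \<open>x - y \<in> A\<^sub>2 y / l\<^sub>1\<close> are the conditions
  \<open>x = J\<^bsub>A\<^sub>1\<^esub> z\<close> and \<open>y = J\<^bsub>A\<^sub>2\<^esub> z\<close>, and the definition of \<open>z\<close> becomes the fixed point equation
  for the resolvent average.  Both maps are continuous because resolvents are nonexpansive.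

  The translation \<open>x = J\<^sub>B z \<longleftrightarrow> z - x \<in> B x\<close> requires that the inclusion on the right be solvable
  for every \<open>z\<close>.  This is Minty's theorem (\<open>minty\<close>), and it carries the analytic weight.  After a
  translation one has to find \<open>x\<close> with \<open>- x \<in> B x\<close>.  Let \<open>F\<close> be the Fitzpatrick function
  \<open>F (x, u) = (SUP (a, b). x \<bullet> b + a \<bullet> u - a \<bullet> b)\<close>, with \<open>(a, b)\<close> ranging over the graph of \<open>B\<close>.
  It is convex, equals \<open>x \<bullet> u\<close> on the graph, and is at least \<open>x \<bullet> u\<close> everywhere by maximality.
  Adding half the square of the norm makes it strongly convex, so that it has a minimiser in the
  complete space \<open>\<H> \<times> \<H>\<close>; the optimality condition there, tested against the points of the
  graph, produces the solution.  Completing squares shows that the minimiser is a weighted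
  Chebyshev centre (\<open>weighted_chebyshev_centre\<close>), which Cantor's intersection theorem provides.
\<close>

section \<open>Weighted Chebyshev centres\<close>

lemma norm_sq_convex_combination:
  fixes w w' c :: "'a::real_inner"
  shows "(norm ((1 - s) *\<^sub>R w + s *\<^sub>R w' - c))\<^sup>2
    = (1 - s) * (norm (w - c))\<^sup>2 + s * (norm (w' - c))\<^sup>2 - s * (1 - s) * (norm (w - w'))\<^sup>2"
  by (simp add: power2_norm_eq_inner inner_diff inner_add inner_commute algebra_simps)

text \<open>
  The supremum of the paraboloids \<open>\<lambda>w. (norm (w - c i))\<^sup>2 - r i\<close> is handled through its epigraph,
  so that the value \<open>\<infinity>\<close> need not be represented.  The function is strongly convex, hence its
  sublevel sets shrink to a point as the level decreases to the infimum, and its values grow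
  quadratically away from that point.  For \<open>r = 0\<close> the minimiser is the centre of the smallest
  ball that contains all \<open>c i\<close>.
\<close>

lemma weighted_chebyshev_centre:
  fixes c :: "'i \<Rightarrow> 'b::{real_inner, complete_space}" and r :: "'i \<Rightarrow> real" and I :: "'i set"
  defines "epi \<equiv> \<lambda>w t. \<forall>i\<in>I. (norm (w - c i))\<^sup>2 - r i \<le> t"
  assumes "I \<noteq> {}" and proper: "epi w1 t1"
  obtains w0 m where "epi w0 m" and "\<And>w t. epi w t \<Longrightarrow> m + (norm (w - w0))\<^sup>2 \<le> t"
proof -
  define V where "V = {t. \<exists>w. epi w t}"
  define m where "m = Inf V"
  obtain i where "i \<in> I"
    using \<open>I \<noteq> {}\<close> by blast
  have "- r i \<le> t" if "t \<in> V" for t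
  proof -
    from that obtain w where "(norm (w - c i))\<^sup>2 - r i \<le> t"
      using \<open>i \<in> I\<close> by (auto simp: V_def epi_def)
    moreover have "0 \<le> (norm (w - c i))\<^sup>2"
      by simp
    ultimately show ?thesis
      by linarith
  qed
  then have bdd: "bdd_below V"
    unfolding bdd_below_def by blast
  have "V \<noteq> {}"
    using proper by (auto simp: V_def)
  have lower: "m \<le> t" if "epi w t" for w t
    unfolding m_def using that bdd by (auto simp: V_def intro: cInf_lower)
  have strongly_convex:
    "epi ((1 - s) *\<^sub>R w + s *\<^sub>R w') ((1 - s) * t + s * t' - s * (1 - s) * (norm (w - w'))\<^sup>2)"
    if "epi w t" "epi w' t'" "0 \<le> s" "s \<le> 1" for w w' t t' s
    unfolding epi_def
  proof
    fix i assume "i \<in> I"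
    then have "(1 - s) * ((norm (w - c i))\<^sup>2 - r i) \<le> (1 - s) * t"
      and "s * ((norm (w' - c i))\<^sup>2 - r i) \<le> s * t'"
      using that by (auto simp: epi_def intro!: mult_left_mono)
    then show "(norm ((1 - s) *\<^sub>R w + s *\<^sub>R w' - c i))\<^sup>2 - r i
        \<le> (1 - s) * t + s * t' - s * (1 - s) * (norm (w - w'))\<^sup>2"
      unfolding norm_sq_convex_combination by (simp add: algebra_simps)
  qed
  define S where "S n = {w. epi w (m + 1 / real (Suc n))}" for n
  obtain w0 where w0: "w0 \<in> S n" for n
  proof (rule decreasing_closed_nest[of S])
    fix n
    have "S n = (\<Inter>i\<in>I. {w. (norm (w - c i))\<^sup>2 - r i \<le> m + 1 / real (Suc n)})"
      by (auto simp: S_def epi_def)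
    then show "closed (S n)"
      by (auto intro!: closed_INT closed_Collect_le continuous_intros)
    have "Inf V < m + 1 / real (Suc n)"
      by (simp add: m_def)
    from cInf_lessD[OF \<open>V \<noteq> {}\<close> this] obtain w t where "epi w t" and "t < m + 1 / real (Suc n)"
      by (auto simp: V_def)
    then have "w \<in> S n"
      by (force simp: S_def epi_def)
    then show "S n \<noteq> {}"
      by blast
  next
    fix k n :: nat assume "k \<le> n"
    then have "1 / real (Suc n) \<le> 1 / real (Suc k)"
      by (simp add: frac_le)
    then show "S n \<subseteq> S k"
      by (fastforce simp: S_def epi_def)
  next
    fix e :: real assume "0 < e"
    then obtain n where n: "1 / real (Suc n) < e\<^sup>2 / 4"
      using nat_approx_posE[of "e\<^sup>2 / 4"] by auto
    have "dist w w' < e" if "w \<in> S n" "w' \<in> S n" for w w'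
    proof -
      have "m \<le> m + 1 / real (Suc n) - (norm (w - w'))\<^sup>2 / 4"
        using lower[OF strongly_convex[of w _ w' _ "1/2"]] that by (fastforce simp: S_def)
      then have "(norm (w - w'))\<^sup>2 < e\<^sup>2"
        using n by simp
      then show ?thesis
        using \<open>0 < e\<close> by (simp add: dist_norm power2_less_imp_less)
    qed
    then show "\<exists>n. \<forall>w\<in>S n. \<forall>w'\<in>S n. dist w w' < e"
      by blast
  qed (use that in blast)
  have "epi w0 m"
    unfolding epi_def
  proof
    fix i assume "i \<in> I"
    show "(norm (w0 - c i))\<^sup>2 - r i \<le> m"
    proof (rule field_le_epsilon)
      fix e :: real assume "0 < e"
      then obtain n where "1 / real (Suc n) < e"
        by (rule nat_approx_posE)
      then show "(norm (w0 - c i))\<^sup>2 - r i \<le> m + e"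
        using w0[of n] \<open>i \<in> I\<close> by (fastforce simp: S_def epi_def)
    qed
  qed
  moreover have "m + (norm (w - w0))\<^sup>2 \<le> t" if "epi w t" for w t
  proof -
    have "z * (norm (w - w0))\<^sup>2 \<le> t - m" if z: "0 < z" "z < 1" for z
    proof -
      \<comment> \<open>Move from the minimiser towards \<open>w\<close> by the fraction \<open>1 - z\<close>; the limit \<open>z \<rightarrow> 1\<close>
        gives the sharp constant.\<close>
      have "m \<le> (1 - (1 - z)) * m + (1 - z) * t - (1 - z) * (1 - (1 - z)) * (norm (w0 - w))\<^sup>2"
        using z by (intro lower[OF strongly_convex[OF \<open>epi w0 m\<close> \<open>epi w t\<close>]]) auto
      then have "(1 - z) * (z * (norm (w - w0))\<^sup>2) \<le> (1 - z) * (t - m)"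
        by (simp add: norm_minus_commute algebra_simps)
      then show ?thesis
        using z by simp
    qed
    then show ?thesis
      using field_le_mult_one_interval[of "(norm (w - w0))\<^sup>2" "t - m"] by simp
  qed
  ultimately show thesis
    by (rule that)
qed


section \<open>Minty's theorem\<close>

text \<open>
  Maximality, seen pointwise: the graph contains every pair that is monotonically related to it,
  since otherwise that pair could be added.  In this form the property visibly survives scaling
  and translation of the values.
\<close>

lemma maximal_monotone_iff:
  "maximal_monotone B \<longleftrightarrow>
    (\<forall>x u. u \<in> B x \<longleftrightarrow> (\<forall>a b. b \<in> B a \<longrightarrow> 0 \<le> (x - a) \<bullet> (u - b)))" (is "_ \<longleftrightarrow> ?polar")
proof
  assume max: "maximal_monotone B"
  then have mono: "0 \<le> (x - y) \<bullet> (u - v)" if "u \<in> B x" "v \<in> B y" for x y u v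
    using that by (auto simp: maximal_monotone_def monotone_operator_def op_graph_def)
  have "u \<in> B x" if rel: "\<And>a b. b \<in> B a \<Longrightarrow> 0 \<le> (x - a) \<bullet> (u - b)" for x u
  proof -
    define C where "C = (\<lambda>y. B y \<union> {v. y = x \<and> v = u})"
    have rel': "0 \<le> (a - x) \<bullet> (b - u)" if "b \<in> B a" for a b
      using rel[OF that] by (simp add: inner_diff algebra_simps)
    have "monotone_operator C"
      using mono rel rel' by (auto simp: monotone_operator_def op_graph_def C_def)
    moreover have "op_graph B \<subseteq> op_graph C"
      by (auto simp: op_graph_def C_def)
    ultimately have "op_graph C = op_graph B"
      using max by (auto simp: maximal_monotone_def)
    moreover have "(x, u) \<in> op_graph C"
      by (simp add: op_graph_def C_def)
    ultimately show ?thesis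
      by (simp add: op_graph_def)
  qed
  with mono show ?polar
    by blast
next
  assume polar: ?polar
  then have "0 \<le> (x - y) \<bullet> (u - v)" if "u \<in> B x" "v \<in> B y" for x y u v
    using that by blast
  then have "monotone_operator B"
    by (simp add: monotone_operator_def op_graph_def)
  moreover have "op_graph C = op_graph B"
    if mono: "monotone_operator C" and sub: "op_graph B \<subseteq> op_graph C" for C
  proof -
    have "u \<in> B x" if "u \<in> C x" for x u
    proof -
      have "0 \<le> (x - a) \<bullet> (u - b)" if "b \<in> B a" for a b
        using mono sub that \<open>u \<in> C x\<close> by (fastforce simp: monotone_operator_def op_graph_def)
      then show ?thesis
        using polar by blast
    qed
    with sub show ?thesis
      by (auto simp: op_graph_def)
  qed
  ultimately show "maximal_monotone B"
    unfolding maximal_monotone_def by blast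
qed

lemma maximal_monotone_translate:
  assumes "maximal_monotone B"
  shows "maximal_monotone (\<lambda>x. {u. u + y \<in> B x})"
  unfolding maximal_monotone_iff
proof (intro allI)
  fix x u
  have "u + y \<in> B x \<longleftrightarrow> (\<forall>a b. b \<in> B a \<longrightarrow> 0 \<le> (x - a) \<bullet> (u + y - b))"
    using assms unfolding maximal_monotone_iff by blast
  also have "\<dots> \<longleftrightarrow> (\<forall>a b. b + y \<in> B a \<longrightarrow> 0 \<le> (x - a) \<bullet> (u - b))"
    by (metis add_diff_cancel_right diff_add_cancel)
  finally show "u \<in> {u. u + y \<in> B x} \<longleftrightarrow>
      (\<forall>a b. b \<in> {u. u + y \<in> B a} \<longrightarrow> 0 \<le> (x - a) \<bullet> (u - b))"
    by simp
qed

lemma mem_op_div_iff: "c \<noteq> 0 \<Longrightarrow> u \<in> op_div B c x \<longleftrightarrow> c *\<^sub>R u \<in> B x"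
  unfolding op_div_def by force

lemma maximal_monotone_op_div:
  assumes "maximal_monotone B" and "0 < c"
  shows "maximal_monotone (op_div B c)"
  unfolding maximal_monotone_iff
proof (intro allI)
  fix x u
  have "c *\<^sub>R u \<in> B x \<longleftrightarrow> (\<forall>a b. b \<in> B a \<longrightarrow> 0 \<le> (x - a) \<bullet> (c *\<^sub>R u - b))"
    using assms(1) unfolding maximal_monotone_iff by blast
  also have "\<dots> \<longleftrightarrow> (\<forall>a b. c *\<^sub>R b \<in> B a \<longrightarrow> 0 \<le> (x - a) \<bullet> (c *\<^sub>R u - c *\<^sub>R b))"
  proof -
    have "b = c *\<^sub>R (b /\<^sub>R c)" for b :: 'a
      using \<open>0 < c\<close> by simp
    then show ?thesis
      by metis
  qed
  also have "\<dots> \<longleftrightarrow> (\<forall>a b. c *\<^sub>R b \<in> B a \<longrightarrow> 0 \<le> (x - a) \<bullet> (u - b))"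
    using \<open>0 < c\<close> by (simp add: zero_le_mult_iff flip: scaleR_diff_right)
  finally show "u \<in> op_div B c x \<longleftrightarrow>
      (\<forall>a b. b \<in> op_div B c a \<longrightarrow> 0 \<le> (x - a) \<bullet> (u - b))"
    using \<open>0 < c\<close> by (simp add: mem_op_div_iff)
qed

lemma norm_Pair_sq: "(norm (x, y))\<^sup>2 = (norm x)\<^sup>2 + (norm y)\<^sup>2"
  by (simp add: norm_Pair)

text \<open>
  The core of Minty's theorem.  With \<open>F\<close> the Fitzpatrick function, the function to be minimised is
  \<open>2 * F (x, u) + (norm (x, u))\<^sup>2\<close>.  Completing squares writes it as the supremum over the graph of
  \<open>(norm (x + b))\<^sup>2 + (norm (u + a))\<^sup>2 - (norm (a + b))\<^sup>2\<close>, a supremum of paraboloids with centres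
  \<open>(- b, - a)\<close>.  Its value at a point \<open>(a, b)\<close> of the graph is \<open>(norm (a + b))\<^sup>2\<close>, while by
  maximality it is at least \<open>(norm (x + u))\<^sup>2\<close> everywhere.  Inserting both in the quadratic growth
  estimate at the minimiser \<open>(x0, u0)\<close> gives
  \<open>(norm (x0 + u0))\<^sup>2 \<le> (a + u0) \<bullet> (b + x0)\<close> on the graph.  Hence \<open>(- u0, - x0)\<close> is monotonically
  related to the graph and so belongs to it; and the estimate at this very point says
  \<open>u0 = - x0\<close>.
\<close>

lemma maximal_monotone_meets_antidiagonal:
  fixes B :: "'a::{real_inner, complete_space} \<Rightarrow> 'a set"
  assumes "maximal_monotone B"
  obtains x where "- x \<in> B x"
proof -
  have polar: "u \<in> B x \<longleftrightarrow> (\<forall>a b. b \<in> B a \<longrightarrow> 0 \<le> (x - a) \<bullet> (u - b))" for x u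
    using assms unfolding maximal_monotone_iff by blast
  define c where "c = (\<lambda>(a::'a, b::'a). (- b, - a))"
  define r where "r = (\<lambda>(a::'a, b). (norm (a + b))\<^sup>2)"
  have value_at: "(norm ((x, u) - c (a, b)))\<^sup>2 - r (a, b)
      = (norm (x + u))\<^sup>2 - 2 * ((x - a) \<bullet> (u - b))" for x u a b
    by (simp add: c_def r_def norm_Pair_sq power2_norm_eq_inner inner_add inner_diff inner_commute
        algebra_simps)
  have "op_graph B \<noteq> {}"
    using polar[of 0 0] by (auto simp: op_graph_def)
  have on_graph: "\<forall>i\<in>op_graph B. (norm ((a, b) - c i))\<^sup>2 - r i \<le> (norm (a + b))\<^sup>2"
    if "b \<in> B a" for a b
    using that polar[of b a] by (auto simp: op_graph_def value_at)
  from \<open>op_graph B \<noteq> {}\<close> obtain a1 b1 where "b1 \<in> B a1"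
    by (auto simp: op_graph_def)
  obtain w0 m where min: "\<forall>i\<in>op_graph B. (norm (w0 - c i))\<^sup>2 - r i \<le> m"
    and growth: "\<And>w t. \<forall>i\<in>op_graph B. (norm (w - c i))\<^sup>2 - r i \<le> t \<Longrightarrow> m + (norm (w - w0))\<^sup>2 \<le> t"
    using weighted_chebyshev_centre[OF \<open>op_graph B \<noteq> {}\<close> on_graph[OF \<open>b1 \<in> B a1\<close>]] by blast
  obtain x0 u0 where w0: "w0 = (x0, u0)"
    by (cases w0)
  have "\<exists>a b. b \<in> B a \<and> (x0 - a) \<bullet> (u0 - b) \<le> 0"
  proof (cases "u0 \<in> B x0")
    case True
    then show ?thesis
      by (intro exI[of _ x0] exI[of _ u0]) simp
  next
    case False
    then show ?thesis
      using polar[of u0 x0] by force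
  qed
  then obtain a b where "b \<in> B a" and neg: "(x0 - a) \<bullet> (u0 - b) \<le> 0"
    by blast
  then have "(norm (x0 + u0))\<^sup>2 - 2 * ((x0 - a) \<bullet> (u0 - b)) \<le> m"
    using min by (auto simp: op_graph_def w0 simp flip: value_at)
  with neg have m: "(norm (x0 + u0))\<^sup>2 \<le> m"
    by linarith
  have key: "(norm (x0 + u0))\<^sup>2 \<le> (a + u0) \<bullet> (b + x0)" if "b \<in> B a" for a b
  proof -
    have "(norm (x0 + u0))\<^sup>2 + (norm ((a, b) - (x0, u0)))\<^sup>2 \<le> (norm (a + b))\<^sup>2"
      using growth[OF on_graph[OF that]] m by (simp add: w0)
    then show ?thesis
      by (simp add: norm_Pair_sq power2_norm_eq_inner inner_add inner_diff inner_commute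
          algebra_simps)
  qed
  have "- x0 \<in> B (- u0)"
  proof (intro polar[THEN iffD2] allI impI)
    fix a b assume "b \<in> B a"
    have "0 \<le> (norm (x0 + u0))\<^sup>2"
      by simp
    also have "\<dots> \<le> (- u0 - a) \<bullet> (- x0 - b)"
      using key[OF \<open>b \<in> B a\<close>] by (simp add: inner_add inner_diff inner_commute algebra_simps)
    finally show "0 \<le> (- u0 - a) \<bullet> (- x0 - b)" .
  qed
  moreover from key[OF this] have "- u0 = x0"
    by (simp add: add_eq_0_iff)
  ultimately show thesis
    using that[of x0] by simp
qed

theorem minty:
  fixes B :: "'a::{real_inner, complete_space} \<Rightarrow> 'a set"
  assumes "maximal_monotone B"
  obtains x where "y - x \<in> B x"
proof -
  obtain x where "- x \<in> {u. u + y \<in> B x}"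
    using maximal_monotone_meets_antidiagonal[OF maximal_monotone_translate[OF assms]] .
  then show thesis
    using that[of x] by simp
qed


section \<open>Resolvents\<close>

text \<open>
  Adding the identity turns monotonicity into expansiveness.  Uniqueness of the value of the
  resolvent and its Lipschitz continuity are two readings of this estimate.
\<close>

lemma monotone_resolvent_nonexpansive:
  assumes "monotone_operator B" and "y - x \<in> B x" and "y' - x' \<in> B x'"
  shows "norm (x - x') \<le> norm (y - y')"
proof -
  have "0 \<le> (x - x') \<bullet> ((y - x) - (y' - x'))"
    using assms by (fastforce simp: monotone_operator_def op_graph_def)
  then have "(norm (x - x'))\<^sup>2 \<le> (x - x') \<bullet> (y - y')"
    by (simp add: power2_norm_eq_inner inner_diff algebra_simps)
  also have "\<dots> \<le> norm (x - x') * norm (y - y')"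
    by (rule norm_cauchy_schwarz)
  finally show ?thesis
    by (cases "x = x'") (simp_all add: power2_eq_square)
qed

lemma resolvent_eq_iff:
  fixes B :: "'a::{real_inner, complete_space} \<Rightarrow> 'a set"
  assumes "maximal_monotone B"
  shows "resolvent B y = x \<longleftrightarrow> y - x \<in> B x"
proof -
  have mono: "monotone_operator B"
    using assms by (simp add: maximal_monotone_def)
  obtain p where p: "y - p \<in> B p"
    using minty[OF assms] .
  have unique: "x = p" if "y - x \<in> B x" for x
    using monotone_resolvent_nonexpansive[OF mono that p] by simp
  have "op_inverse (op_add B op_Id) y = {x. y - x \<in> B x}"
    by (force simp: op_inverse_def op_add_def op_Id_def)
  also have "\<dots> = {p}"
    using p unique by blast
  finally have "resolvent B y = p"
    by (simp add: resolvent_def)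
  with p unique show ?thesis
    by blast
qed

lemma continuous_on_resolvent:
  fixes B :: "'a::{real_inner, complete_space} \<Rightarrow> 'a set"
  assumes "maximal_monotone B"
  shows "continuous_on X (resolvent B)"
proof -
  have "y - resolvent B y \<in> B (resolvent B y)" for y
    using resolvent_eq_iff[OF assms] by blast
  then have "dist (resolvent B y) (resolvent B y') \<le> dist y y'" for y y'
    using assms unfolding dist_norm maximal_monotone_def
    by (blast intro: monotone_resolvent_nonexpansive)
  then show ?thesis
    unfolding continuous_on_iff by (meson le_less_trans)
qed


section \<open>Cycles and fixed points\<close>

lemma resolvent_op_div_eq_iff:
  fixes B :: "'a::{real_inner, complete_space} \<Rightarrow> 'a set"
  assumes "maximal_monotone B" and "0 < l" and "k + l = 1"
  shows "x = resolvent (op_div B l) y \<longleftrightarrow> resolvent B (k *\<^sub>R x + l *\<^sub>R y) = x"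
proof -
  have "x = resolvent (op_div B l) y \<longleftrightarrow> l *\<^sub>R (y - x) \<in> B x"
    using resolvent_eq_iff[OF maximal_monotone_op_div[OF assms(1,2)], of y x] \<open>0 < l\<close>
    by (auto simp: mem_op_div_iff)
  also have "l *\<^sub>R (y - x) = k *\<^sub>R x + l *\<^sub>R y - x"
  proof -
    have "k = 1 - l"
      using \<open>k + l = 1\<close> by simp
    then show ?thesis
      by (simp only:) (simp add: algebra_simps)
  qed
  finally show ?thesis
    by (simp add: resolvent_eq_iff[OF assms(1)])
qed

theorem theorem3p6:
  fixes A\<^sub>1 A\<^sub>2 :: "'a::{real_inner, complete_space} \<Rightarrow> 'a set"
    and l\<^sub>1 l\<^sub>2 :: real
  assumes "maximal_monotone A\<^sub>1" and "maximal_monotone A\<^sub>2"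
    and "l\<^sub>1 > 0" and "l\<^sub>2 > 0" and "l\<^sub>1 + l\<^sub>2 = 1"
  shows "homeomorphism
           (resolvent_cycles l\<^sub>1 l\<^sub>2 A\<^sub>1 A\<^sub>2)
           (Fix (resolvent_average l\<^sub>1 l\<^sub>2 A\<^sub>1 A\<^sub>2))
           (\<lambda>(x, y). l\<^sub>1 *\<^sub>R x + l\<^sub>2 *\<^sub>R y)
           (\<lambda>z. (resolvent A\<^sub>1 z, resolvent A\<^sub>2 z))
       \<and> Fix (resolvent_average l\<^sub>1 l\<^sub>2 A\<^sub>1 A\<^sub>2)
           = (\<lambda>(x, y). l\<^sub>1 *\<^sub>R x + l\<^sub>2 *\<^sub>R y) ` resolvent_cycles l\<^sub>1 l\<^sub>2 A\<^sub>1 A\<^sub>2"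
proof -
  let ?S = "resolvent_cycles l\<^sub>1 l\<^sub>2 A\<^sub>1 A\<^sub>2"
  let ?F = "Fix (resolvent_average l\<^sub>1 l\<^sub>2 A\<^sub>1 A\<^sub>2)"
  let ?T = "\<lambda>(x, y). l\<^sub>1 *\<^sub>R x + l\<^sub>2 *\<^sub>R y"
  let ?J = "\<lambda>z. (resolvent A\<^sub>1 z, resolvent A\<^sub>2 z)"
  have cycle_iff: "w \<in> ?S \<longleftrightarrow> ?J (?T w) = w" for w
  proof (cases w)
    case (Pair x y)
    have "x = resolvent (op_div A\<^sub>1 l\<^sub>2) y \<longleftrightarrow> resolvent A\<^sub>1 (l\<^sub>1 *\<^sub>R x + l\<^sub>2 *\<^sub>R y) = x"
      using assms by (intro resolvent_op_div_eq_iff)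
    moreover have "y = resolvent (op_div A\<^sub>2 l\<^sub>1) x \<longleftrightarrow> resolvent A\<^sub>2 (l\<^sub>2 *\<^sub>R y + l\<^sub>1 *\<^sub>R x) = y"
      using assms by (intro resolvent_op_div_eq_iff) auto
    ultimately show ?thesis
      by (simp add: Pair resolvent_cycles_def add.commute)
  qed
  have fix_iff: "z \<in> ?F \<longleftrightarrow> ?T (?J z) = z" for z
    by (simp add: Fix_def resolvent_average_def)
  have "homeomorphism ?S ?F ?T ?J"
  proof (rule homeomorphismI)
    show "continuous_on ?S ?T"
      by (auto simp: case_prod_beta intro!: continuous_intros)
    show "continuous_on ?F ?J"
      using assms by (intro continuous_on_Pair continuous_on_resolvent)
    show "?T ` ?S \<subseteq> ?F"
      unfolding image_subset_iff fix_iff using cycle_iff by metis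
    show "?J ` ?F \<subseteq> ?S"
      unfolding image_subset_iff cycle_iff using fix_iff by metis
  qed (use cycle_iff fix_iff in auto)
  then show ?thesis
    using homeomorphism_image1 by blast
qed

end
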